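(* Let $p$ be a prime number and let $\mathbb Z_p$ be the ring of $p$-adic integers. A function $f\colon\mathbb Z_p\to\mathbb Z_p$ is $\langle\mathbb Z_p;+,\times\rangle$-congruence preserving if and only if for every $\langle\mathbb Z_p;+,\times\rangle$-recognizable subset $L$ of $\mathbb Z_p$, the lattice $\mathfrak L_{\langle\mathbb Z_p;+,\times\rangle}(L)$ is closed under $f^{-1}$.
   Context: A congruence of $\langle\mathbb Z_p;+,\times\rangle$ is an equivalence relation on $\mathbb Z_p$ compatible with $+$ and $\times$. $f$ is congruence preserving if for every such congruence $\sim$, $x\sim y$ implies $f(x)\sim f(y)$. $L\subseteq\mathbb Z_p$ is recognizable if there are a finite algebra $\langle M;\oplus,\otimes\rangle$ with two binary operations and a surjective morphism $\varphi\colon\langle\mathbb Z_p;+,\times\rangle\to\langle M;\oplus,\otimes\rangle$ with $L=\varphi^{-1}(\varphi(L))$. A lattice of subsets of $\mathbb Z_p$ means a bounded one: a family of subsets containing $\mathbb Z_p$ and $\emptyset$ and closed under binary unions and intersections. $\mathfrak L_{\langle\mathbb Z_p;+,\times\rangle}(L)$ is the smallest lattice of subsets of $\mathbb Z_p$ which contains $L$ and is closed under $X\mapsto\{x\mid x+a\in X\}$ and $X\mapsto\{x\mid ax\in X\}$ for all $a\in\mathbb Z_p$. A lattice $\mathfrak L$ is closed under $f^{-1}$ if $X\in\mathfrak L$ implies $f^{-1}(X)\in\mathfrak L$. *)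

theory Defs
  imports "HOL-Algebra.Ring" "HOL-Computational_Algebra.Primes"
begin

text \<open>The ring of \<open>p\<close>-adic integers as the inverse limit of the rings \<open>\<int>/p^n\<int>\<close>: the \<open>n\<close>-th
  component of an element is the representative of its residue class in \<open>{0..<p^n}\<close>.\<close>

definition padic_ints :: "nat \<Rightarrow> (nat \<Rightarrow> int) ring" where
  "padic_ints p =
    \<lparr> carrier = {x. (\<forall>n. x n \<in> {0..<int p ^ n}) \<and> (\<forall>m n. m \<le> n \<longrightarrow> x n mod int p ^ m = x m)},
      monoid.mult = (\<lambda>x y n. (x n * y n) mod int p ^ n),
      one = (\<lambda>n. 1 mod int p ^ n),
      zero = (\<lambda>n. 0),
      add = (\<lambda>x y n. (x n + y n) mod int p ^ n) \<rparr>"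

lemma padic_ints_cring:
  assumes "p > 0"
  shows "cring (padic_ints p)"
proof -
  let ?Z = "padic_ints p"
  let ?C = "carrier ?Z"
  have ops: "x \<oplus>\<^bsub>?Z\<^esub> y = (\<lambda>n. (x n + y n) mod int p ^ n)"
      "x \<otimes>\<^bsub>?Z\<^esub> y = (\<lambda>n. (x n * y n) mod int p ^ n)"
      "\<zero>\<^bsub>?Z\<^esub> = (\<lambda>n. 0 mod int p ^ n)" "\<one>\<^bsub>?Z\<^esub> = (\<lambda>n. 1 mod int p ^ n)" for x y
    by (simp_all add: padic_ints_def)
  have C: "x n mod int p ^ m = x m" if "x \<in> ?C" "m \<le> n" for x m n
    using that by (simp add: padic_ints_def)
  have id: "(\<lambda>n. x n mod int p ^ n) = x" if "x \<in> ?C" for x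
    using C[OF that] by simp
  have red: "(\<lambda>n. z n mod int p ^ n) \<in> ?C"
    if z: "\<And>m n. m \<le> n \<Longrightarrow> z n mod int p ^ m = z m mod int p ^ m" for z
  proof -
    have "(z n mod int p ^ n) mod int p ^ m = z m mod int p ^ m" if "m \<le> n" for m n
      using z[OF that] le_imp_power_dvd[OF that, of "int p"] by (simp add: mod_mod_cancel)
    moreover have "int p ^ n > 0" for n using assms by simp
    ultimately show ?thesis by (simp add: padic_ints_def)
  qed
  have add: "x \<oplus>\<^bsub>?Z\<^esub> y \<in> ?C" if "x \<in> ?C" "y \<in> ?C" for x y
    unfolding ops by (rule red, rule mod_add_cong) (use C that in auto)
  have mul: "x \<otimes>\<^bsub>?Z\<^esub> y \<in> ?C" if "x \<in> ?C" "y \<in> ?C" for x y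
    unfolding ops by (rule red, rule mod_mult_cong) (use C that in auto)
  have neg: "(\<lambda>n. (- x n) mod int p ^ n) \<in> ?C" if "x \<in> ?C" for x
    by (rule red, rule mod_minus_cong) (use C that in auto)
  have zero: "\<zero>\<^bsub>?Z\<^esub> \<in> ?C" and one: "\<one>\<^bsub>?Z\<^esub> \<in> ?C"
    unfolding ops by (rule red, rule refl)+
  show ?thesis
  proof (rule cringI)
    show "abelian_group ?Z"
    proof (rule abelian_groupI)
      fix x assume x: "x \<in> ?C"
      show "\<exists>y\<in>?C. y \<oplus>\<^bsub>?Z\<^esub> x = \<zero>\<^bsub>?Z\<^esub>"
        by (rule bexI[OF _ neg[OF x]]) (simp add: ops mod_simps)
      show "\<zero>\<^bsub>?Z\<^esub> \<oplus>\<^bsub>?Z\<^esub> x = x"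
        using id[OF x] by (simp add: ops)
    next
      fix x y z
      show "(x \<oplus>\<^bsub>?Z\<^esub> y) \<oplus>\<^bsub>?Z\<^esub> z = x \<oplus>\<^bsub>?Z\<^esub> (y \<oplus>\<^bsub>?Z\<^esub> z)"
        by (simp add: ops mod_simps add.assoc)
      show "x \<oplus>\<^bsub>?Z\<^esub> y = y \<oplus>\<^bsub>?Z\<^esub> x" by (simp add: ops add.commute)
    qed (fact add zero)+
    show "Group.comm_monoid ?Z"
    proof (rule comm_monoidI)
      fix x assume x: "x \<in> ?C"
      show "\<one>\<^bsub>?Z\<^esub> \<otimes>\<^bsub>?Z\<^esub> x = x"
        using id[OF x] by (simp add: ops mod_simps)
    next
      fix x y z
      show "(x \<otimes>\<^bsub>?Z\<^esub> y) \<otimes>\<^bsub>?Z\<^esub> z = x \<otimes>\<^bsub>?Z\<^esub> (y \<otimes>\<^bsub>?Z\<^esub> z)"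
        by (simp add: ops mod_simps mult.assoc)
      show "x \<otimes>\<^bsub>?Z\<^esub> y = y \<otimes>\<^bsub>?Z\<^esub> x" by (simp add: ops mult.commute)
    qed (fact mul one)+
    fix x y z
    show "(x \<oplus>\<^bsub>?Z\<^esub> y) \<otimes>\<^bsub>?Z\<^esub> z = x \<otimes>\<^bsub>?Z\<^esub> z \<oplus>\<^bsub>?Z\<^esub> y \<otimes>\<^bsub>?Z\<^esub> z"
      by (simp add: ops mod_simps distrib_right)
  qed
qed

text \<open>Only the two operations \<open>\<oplus>\<close> and \<open>\<otimes>\<close> of a ring enter the notions below: they concern
  the algebra \<open>\<langle>R; +, \<times>\<rangle>\<close>.\<close>

definition alg_congruence :: "('a, 'b) ring_scheme \<Rightarrow> ('a \<times> 'a) set \<Rightarrow> bool" where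
  "alg_congruence R r \<longleftrightarrow>
     equiv (carrier R) r \<and>
     (\<forall>x x' y y'. (x, x') \<in> r \<longrightarrow> (y, y') \<in> r \<longrightarrow>
        (x \<oplus>\<^bsub>R\<^esub> y, x' \<oplus>\<^bsub>R\<^esub> y') \<in> r \<and> (x \<otimes>\<^bsub>R\<^esub> y, x' \<otimes>\<^bsub>R\<^esub> y') \<in> r)"

definition congruence_preserving :: "('a, 'b) ring_scheme \<Rightarrow> ('a \<Rightarrow> 'a) \<Rightarrow> bool" where
  "congruence_preserving R f \<longleftrightarrow>
     (\<forall>r. alg_congruence R r \<longrightarrow> (\<forall>x y. (x, y) \<in> r \<longrightarrow> (f x, f y) \<in> r))"

definition recognizes ::
  "('a, 'b) ring_scheme \<Rightarrow> 'm set \<Rightarrow> ('m \<Rightarrow> 'm \<Rightarrow> 'm) \<Rightarrow> ('m \<Rightarrow> 'm \<Rightarrow> 'm) \<Rightarrow> ('a \<Rightarrow> 'm) \<Rightarrow> 'a set \<Rightarrow> bool"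
  where
  "recognizes R M pl tm \<phi> L \<longleftrightarrow>
     finite M \<and>
     (\<forall>u\<in>M. \<forall>v\<in>M. pl u v \<in> M \<and> tm u v \<in> M) \<and>
     \<phi> ` carrier R = M \<and>
     (\<forall>x\<in>carrier R. \<forall>y\<in>carrier R.
        \<phi> (x \<oplus>\<^bsub>R\<^esub> y) = pl (\<phi> x) (\<phi> y) \<and> \<phi> (x \<otimes>\<^bsub>R\<^esub> y) = tm (\<phi> x) (\<phi> y)) \<and>
     L \<subseteq> carrier R \<and> L = {x \<in> carrier R. \<phi> x \<in> \<phi> ` L}"

text \<open>HOL cannot quantify over the type of the elements of the finite algebra. Taking it to be
  \<^typ>\<open>nat\<close> loses nothing, since every finite algebra has an isomorphic copy there; see
  \<open>recognizes_imp_recognizable\<close> below.\<close>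

definition recognizable :: "('a, 'b) ring_scheme \<Rightarrow> 'a set \<Rightarrow> bool" where
  "recognizable R L \<longleftrightarrow> (\<exists>(M :: nat set) pl tm \<phi>. recognizes R M pl tm \<phi> L)"

lemma recognizes_imp_recognizable:
  fixes M :: "'m set"
  assumes "recognizes R M pl tm \<phi> L"
  shows "recognizable R L"
proof -
  note * = assms[unfolded recognizes_def]
  obtain h :: "'m \<Rightarrow> nat" where h: "inj_on h M"
    using * finite_imp_inj_to_nat_seg by metis
  define g where "g = the_inv_into M h"
  have g: "g (h u) = u" if "u \<in> M" for u
    using that h by (simp add: g_def the_inv_into_f_f)
  have phi: "\<phi> x \<in> M" if "x \<in> carrier R" for x using * that by blast
  have L: "L \<subseteq> carrier R" "\<And>x. x \<in> carrier R \<Longrightarrow> \<phi> x \<in> \<phi> ` L \<Longrightarrow> x \<in> L" using * by blast+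
  have "x \<in> L" if x: "x \<in> carrier R" and i: "h (\<phi> x) \<in> (\<lambda>x. h (\<phi> x)) ` L" for x
  proof -
    from i obtain y where y: "y \<in> L" "h (\<phi> x) = h (\<phi> y)" by blast
    then have "\<phi> x = \<phi> y" using g phi x L(1) by (metis subsetD)
    then show ?thesis using L(2) x y by blast
  qed
  then have eq: "L = {x \<in> carrier R. h (\<phi> x) \<in> (\<lambda>x. h (\<phi> x)) ` L}" using L(1) by blast
  have "recognizes R (h ` M) (\<lambda>a b. h (pl (g a) (g b))) (\<lambda>a b. h (tm (g a) (g b))) (\<lambda>x. h (\<phi> x)) L"
    unfolding recognizes_def
  proof (intro conjI eq L(1))
    show "finite (h ` M)" using * by blast
    show "\<forall>u\<in>h ` M. \<forall>v\<in>h ` M. h (pl (g u) (g v)) \<in> h ` M \<and> h (tm (g u) (g v)) \<in> h ` M"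
      using * by (auto simp: g)
    show "(\<lambda>x. h (\<phi> x)) ` carrier R = h ` M" using * by (metis image_image)
    show "\<forall>x\<in>carrier R. \<forall>y\<in>carrier R. h (\<phi> (x \<oplus>\<^bsub>R\<^esub> y)) = h (pl (g (h (\<phi> x))) (g (h (\<phi> y)))) \<and>
        h (\<phi> (x \<otimes>\<^bsub>R\<^esub> y)) = h (tm (g (h (\<phi> x))) (g (h (\<phi> y))))"
      using * by (simp add: g phi)
  qed
  then show ?thesis unfolding recognizable_def by blast
qed

definition set_lattice :: "'a set \<Rightarrow> 'a set set \<Rightarrow> bool" where
  "set_lattice A F \<longleftrightarrow>
     F \<subseteq> Pow A \<and> A \<in> F \<and> {} \<in> F \<and> (\<forall>X\<in>F. \<forall>Y\<in>F. X \<union> Y \<in> F \<and> X \<inter> Y \<in> F)"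

definition translation_closed :: "('a, 'b) ring_scheme \<Rightarrow> 'a set set \<Rightarrow> bool" where
  "translation_closed R F \<longleftrightarrow>
     (\<forall>X\<in>F. \<forall>a\<in>carrier R.
        {x \<in> carrier R. x \<oplus>\<^bsub>R\<^esub> a \<in> X} \<in> F \<and> {x \<in> carrier R. a \<otimes>\<^bsub>R\<^esub> x \<in> X} \<in> F)"

definition generated_lattice :: "('a, 'b) ring_scheme \<Rightarrow> 'a set \<Rightarrow> 'a set set" where
  "generated_lattice R L =
     \<Inter> {F. set_lattice (carrier R) F \<and> translation_closed R F \<and> L \<in> F}"

definition preimage_closed :: "('a, 'b) ring_scheme \<Rightarrow> ('a \<Rightarrow> 'a) \<Rightarrow> 'a set set \<Rightarrow> bool" where
  "preimage_closed R f F \<longleftrightarrow> (\<forall>X\<in>F. {x \<in> carrier R. f x \<in> X} \<in> F)"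

lemma generated_lattice_least:
  assumes "L \<subseteq> carrier R"
  shows "set_lattice (carrier R) (generated_lattice R L)"
    and "translation_closed R (generated_lattice R L)"
    and "L \<in> generated_lattice R L"
    and "\<lbrakk>set_lattice (carrier R) F; translation_closed R F; L \<in> F\<rbrakk> \<Longrightarrow> generated_lattice R L \<subseteq> F"
proof -
  have "set_lattice (carrier R) (Pow (carrier R)) \<and> translation_closed R (Pow (carrier R))
      \<and> L \<in> Pow (carrier R)"
    using assms by (auto simp: set_lattice_def translation_closed_def)
  then have "generated_lattice R L \<subseteq> Pow (carrier R)"
    unfolding generated_lattice_def by blast
  then show "set_lattice (carrier R) (generated_lattice R L)"
    unfolding generated_lattice_def set_lattice_def by simp
  show "translation_closed R (generated_lattice R L)"
    unfolding generated_lattice_def translation_closed_def by simp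
qed (auto simp: generated_lattice_def)

end

theory Submission
  imports Defs "HOL-Number_Theory.Cong"
begin

text \<open>Both conditions on \<open>f\<close> are compared with a third one: any two values of \<open>f\<close> are
  interpolated by an affine map \<open>z \<mapsto> a z + b\<close> of the ring.

  In every commutative ring, interpolation is the same as preservation of congruences, since the
  principal ideal generated by \<open>x - y\<close> is the least congruence that identifies \<open>x\<close> and \<open>y\<close>
  (\<open>congruence_preserving_iff_affine_interpolation\<close>).

  If \<open>f\<close> is interpolated, let \<open>L\<close> be recognizable. All members of the lattice of \<open>L\<close> are
  unions of classes of one congruence of finite index, so that the lattice is finite. A
  finite lattice of sets contains every set that separates points no better than its members do
  (\<open>finite_set_lattice_mem\<close>), and \<open>f\<^sup>-\<^sup>1(X)\<close> is such a set: if \<open>f x \<in> X\<close> and \<open>f y \<notin> X\<close>, then the preimage of \<open>X\<close>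
  under the affine map that agrees with \<open>f\<close> at \<open>x\<close> and \<open>y\<close> is a member that separates
  \<open>x\<close> from \<open>y\<close>.

  The converse uses the arithmetic of the \<open>p\<close>-adic integers. If all lattices of recognizable sets are closed under
  \<open>f\<^sup>-\<^sup>1\<close>, applying this to the residue classes modulo \<open>p^n\<close> shows that \<open>f\<close> preserves
  congruence modulo \<open>p^n\<close>, for each \<open>n\<close>. As every nonzero \<open>p\<close>-adic integer is a unit times a
  power of \<open>p\<close>, it follows that \<open>x - y\<close> divides \<open>f x - f y\<close>
  (\<open>padic_dvd_if_valuation_le\<close>), and interpolation is possible.\<close>

section \<open>Congruence preservation as affine interpolation\<close>

definition affinely_interpolated :: "('a, 'b) ring_scheme \<Rightarrow> ('a \<Rightarrow> 'a) \<Rightarrow> bool" where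
  "affinely_interpolated R f \<longleftrightarrow>
     (\<forall>x\<in>carrier R. \<forall>y\<in>carrier R. \<exists>a\<in>carrier R. \<exists>b\<in>carrier R.
        f x = a \<otimes>\<^bsub>R\<^esub> x \<oplus>\<^bsub>R\<^esub> b \<and> f y = a \<otimes>\<^bsub>R\<^esub> y \<oplus>\<^bsub>R\<^esub> b)"

lemma (in cring) affinely_interpolatedI:
  assumes f: "f \<in> carrier R \<rightarrow> carrier R"
    and dvd: "\<And>x y. \<lbrakk>x \<in> carrier R; y \<in> carrier R\<rbrakk> \<Longrightarrow> \<exists>a\<in>carrier R. f x \<ominus> f y = a \<otimes> (x \<ominus> y)"
  shows "affinely_interpolated R f"
  unfolding affinely_interpolated_def
proof (intro ballI)
  fix x y assume xy: "x \<in> carrier R" "y \<in> carrier R"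
  then have fxy: "f x \<in> carrier R" "f y \<in> carrier R" using f by auto
  obtain a where a: "a \<in> carrier R" "f x \<ominus> f y = a \<otimes> (x \<ominus> y)" using dvd[OF xy] by blast
  define b where "b = f y \<ominus> a \<otimes> y"
  have b: "b \<in> carrier R" using a xy fxy by (simp add: b_def)
  have "f y = a \<otimes> y \<oplus> b" using a(1) xy fxy unfolding b_def by algebra
  moreover have "f x = (f x \<ominus> f y) \<oplus> f y" using fxy by algebra
  then have "f x = a \<otimes> (x \<ominus> y) \<oplus> f y" unfolding a(2) .
  then have "f x = a \<otimes> x \<oplus> b" using a(1) xy fxy unfolding b_def by algebra
  ultimately show "\<exists>a\<in>carrier R. \<exists>b\<in>carrier R. f x = a \<otimes> x \<oplus> b \<and> f y = a \<otimes> y \<oplus> b"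
    using a(1) b by blast
qed

lemma (in cring) alg_congruence_principal:
  assumes d: "d \<in> carrier R"
  shows "alg_congruence R {(x, y) \<in> carrier R \<times> carrier R. \<exists>a\<in>carrier R. x \<ominus> y = a \<otimes> d}"
    (is "alg_congruence R ?r")
  unfolding alg_congruence_def
proof (intro conjI allI impI)
  show "equiv (carrier R) ?r"
  proof (rule equivI)
    show "?r \<subseteq> carrier R \<times> carrier R" by blast
    have "x \<ominus> x = \<zero> \<otimes> d" if "x \<in> carrier R" for x using that d by algebra
    then show "refl_on (carrier R) ?r" by (auto simp: refl_on_def)
    have "y \<ominus> x = (\<ominus> a) \<otimes> d"
      if "x \<in> carrier R" "y \<in> carrier R" "a \<in> carrier R" "x \<ominus> y = a \<otimes> d" for x y a
    proof -
      have "y \<ominus> x = \<ominus> (x \<ominus> y)" using that(1,2) by algebra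
      then show ?thesis using that(3) d unfolding that(4) by algebra
    qed
    then show "sym ?r" by (intro symI) (blast intro: a_inv_closed)
    have "x \<ominus> z = (a \<oplus> b) \<otimes> d"
      if "x \<in> carrier R" "y \<in> carrier R" "z \<in> carrier R" "a \<in> carrier R" "b \<in> carrier R"
        "x \<ominus> y = a \<otimes> d" "y \<ominus> z = b \<otimes> d" for x y z a b
    proof -
      have "x \<ominus> z = (x \<ominus> y) \<oplus> (y \<ominus> z)" using that(1-3) by algebra
      then show ?thesis using that(4,5) d unfolding that(6,7) by algebra
    qed
    then show "trans ?r" by (intro transI) (blast intro: a_closed)
  qed
next
  fix x x' y y' assume "(x, x') \<in> ?r" "(y, y') \<in> ?r"
  then obtain a b where *: "x \<in> carrier R" "x' \<in> carrier R" "y \<in> carrier R" "y' \<in> carrier R"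
    "a \<in> carrier R" "b \<in> carrier R" and ab: "x \<ominus> x' = a \<otimes> d" "y \<ominus> y' = b \<otimes> d" by blast
  have "(x \<oplus> y) \<ominus> (x' \<oplus> y') = (x \<ominus> x') \<oplus> (y \<ominus> y')" using * by algebra
  also have "\<dots> = (a \<oplus> b) \<otimes> d" using * d unfolding ab by algebra
  finally show "(x \<oplus> y, x' \<oplus> y') \<in> ?r" using * by auto
  have "x \<otimes> y \<ominus> x' \<otimes> y' = x \<otimes> (y \<ominus> y') \<oplus> (x \<ominus> x') \<otimes> y'" using * by algebra
  also have "\<dots> = (x \<otimes> b \<oplus> a \<otimes> y') \<otimes> d" using * d unfolding ab by algebra
  finally show "(x \<otimes> y, x' \<otimes> y') \<in> ?r" using * by auto
qed

text \<open>Affine maps preserve every congruence, and so does a map that agrees with some affine map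
  at any two given points. Conversely, the congruence of the principal ideal generated by
  \<open>x - y\<close> forces \<open>x - y\<close> to divide \<open>f x - f y\<close>, and the quotient is the slope.\<close>

lemma (in cring) congruence_preserving_iff_affine_interpolation:
  assumes f: "f \<in> carrier R \<rightarrow> carrier R"
  shows "congruence_preserving R f \<longleftrightarrow> affinely_interpolated R f"
proof
  assume cp: "congruence_preserving R f"
  show "affinely_interpolated R f"
  proof (rule affinely_interpolatedI[OF f])
    fix x y assume xy: "x \<in> carrier R" "y \<in> carrier R"
    let ?r = "{(u, v) \<in> carrier R \<times> carrier R. \<exists>a\<in>carrier R. u \<ominus> v = a \<otimes> (x \<ominus> y)}"
    have "alg_congruence R ?r" using alg_congruence_principal xy by simp
    moreover have "x \<ominus> y = \<one> \<otimes> (x \<ominus> y)" using xy by simp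
    then have "(x, y) \<in> ?r" using xy one_closed by blast
    ultimately have "(f x, f y) \<in> ?r" using cp unfolding congruence_preserving_def by blast
    then show "\<exists>a\<in>carrier R. f x \<ominus> f y = a \<otimes> (x \<ominus> y)" by blast
  qed
next
  assume int: "affinely_interpolated R f"
  show "congruence_preserving R f"
    unfolding congruence_preserving_def
  proof (intro allI impI)
    fix r x y assume r: "alg_congruence R r" and xy: "(x, y) \<in> r"
    have eq: "equiv (carrier R) r"
      and add: "\<And>x x' y y'. \<lbrakk>(x, x') \<in> r; (y, y') \<in> r\<rbrakk> \<Longrightarrow> (x \<oplus> y, x' \<oplus> y') \<in> r"
      and mul: "\<And>x x' y y'. \<lbrakk>(x, x') \<in> r; (y, y') \<in> r\<rbrakk> \<Longrightarrow> (x \<otimes> y, x' \<otimes> y') \<in> r"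
      using r unfolding alg_congruence_def by blast+
    have refl: "(c, c) \<in> r" if "c \<in> carrier R" for c using eq that by (meson equivE refl_onD)
    have "x \<in> carrier R" "y \<in> carrier R" using eq xy by (auto simp: equiv_def)
    then obtain a b where "a \<in> carrier R" "b \<in> carrier R"
      "f x = a \<otimes> x \<oplus> b" "f y = a \<otimes> y \<oplus> b"
      using int unfolding affinely_interpolated_def by blast
    then show "(f x, f y) \<in> r" using add mul refl xy by metis
  qed
qed

section \<open>Lattices generated by recognizable sets\<close>

text \<open>The sets saturated under the kernel of \<open>\<phi>\<close> form a lattice closed under the two
  operations on sets, because \<open>\<phi>\<close> is a morphism; so the lattice of \<open>L\<close> stays inside it.\<close>

lemma generated_lattice_saturated:
  fixes R (structure)
  assumes R: "cring R" and rec: "recognizes R M pl tm \<phi> L"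
    and X: "X \<in> generated_lattice R L" and xX: "x \<in> X"
    and y: "y \<in> carrier R" and eq: "\<phi> x = \<phi> y"
  shows "y \<in> X"
proof -
  interpret cring R by (rule R)
  note * = rec[unfolded recognizes_def]
  let ?F = "{X. X \<subseteq> carrier R \<and> (\<forall>x\<in>X. \<forall>y\<in>carrier R. \<phi> x = \<phi> y \<longrightarrow> y \<in> X)}"
  have hom: "\<phi> (u \<oplus> v) = pl (\<phi> u) (\<phi> v)" "\<phi> (u \<otimes> v) = tm (\<phi> u) (\<phi> v)"
    if "u \<in> carrier R" "v \<in> carrier R" for u v
    using *[THEN conjunct2, THEN conjunct2, THEN conjunct2, THEN conjunct1] that by simp_all
  have L: "L \<subseteq> carrier R" "\<And>x. x \<in> carrier R \<Longrightarrow> \<phi> x \<in> \<phi> ` L \<Longrightarrow> x \<in> L"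
    using * by blast+
  have "set_lattice (carrier R) ?F" unfolding set_lattice_def by blast
  moreover have "translation_closed R ?F"
    unfolding translation_closed_def
  proof (intro ballI conjI)
    fix X a assume X: "X \<in> ?F" and a: "a \<in> carrier R"
    have "\<phi> (u \<oplus> a) = \<phi> (v \<oplus> a)" "\<phi> (a \<otimes> u) = \<phi> (a \<otimes> v)"
      if "u \<in> carrier R" "v \<in> carrier R" "\<phi> u = \<phi> v" for u v using that a hom by simp_all
    moreover have "v \<in> X" if "u \<in> X" "v \<in> carrier R" "\<phi> u = \<phi> v" for u v
      using X that by blast
    ultimately show "{x \<in> carrier R. x \<oplus> a \<in> X} \<in> ?F" "{x \<in> carrier R. a \<otimes> x \<in> X} \<in> ?F"
      using a by (simp_all add: subset_iff) (metis a_closed, metis m_closed)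
  qed
  moreover have "y \<in> L" if "x \<in> L" "y \<in> carrier R" "\<phi> x = \<phi> y" for x y
    using L(2)[OF that(2)] that(1,3) by (metis image_eqI)
  then have "L \<in> ?F" using L(1) by blast
  ultimately have "generated_lattice R L \<subseteq> ?F" by (rule generated_lattice_least(4)[OF L(1)])
  then show ?thesis using X xX y eq by blast
qed

lemma finite_generated_lattice:
  assumes R: "cring R" and rec: "recognizable R L"
  shows "finite (generated_lattice R L)"
proof -
  obtain M :: "nat set" and pl tm \<phi> where rec: "recognizes R M pl tm \<phi> L"
    using rec unfolding recognizable_def by blast
  then have M: "finite M" "\<phi> ` carrier R = M" and L: "L \<subseteq> carrier R"
    unfolding recognizes_def by blast+
  have sub: "X \<subseteq> carrier R" if "X \<in> generated_lattice R L" for X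
    using generated_lattice_least(1)[OF L] that unfolding set_lattice_def by blast
  have "X = {y \<in> carrier R. \<phi> y \<in> \<phi> ` X}" if "X \<in> generated_lattice R L" for X
    using sub[OF that] generated_lattice_saturated[OF R rec that] by auto
  moreover have "\<phi> ` X \<in> Pow M" if "X \<in> generated_lattice R L" for X
    using sub[OF that] M(2) by blast
  ultimately have "generated_lattice R L \<subseteq> (\<lambda>S. {y \<in> carrier R. \<phi> y \<in> S}) ` Pow M" by blast
  then show ?thesis by (rule finite_subset) (use M(1) in simp)
qed

text \<open>In a finite lattice of sets, the intersection \<open>I x\<close> of all members around \<open>x\<close> is itself
  a member, and \<open>Y\<close> is the union of the finitely many \<open>I x\<close> with \<open>x \<in> Y\<close>.\<close>

lemma finite_set_lattice_mem:
  assumes lat: "set_lattice A F" and fin: "finite F" and YA: "Y \<subseteq> A"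
    and sep: "\<And>x y. \<lbrakk>x \<in> Y; y \<in> A; \<And>Z. \<lbrakk>Z \<in> F; x \<in> Z\<rbrakk> \<Longrightarrow> y \<in> Z\<rbrakk> \<Longrightarrow> y \<in> Y"
  shows "Y \<in> F"
proof -
  define I where "I x = \<Inter> {Z \<in> F. x \<in> Z}" for x
  have F: "A \<in> F" "{} \<in> F" "F \<subseteq> Pow A" "\<And>X Y. X \<in> F \<Longrightarrow> Y \<in> F \<Longrightarrow> X \<union> Y \<in> F"
    "\<And>X Y. X \<in> F \<Longrightarrow> Y \<in> F \<Longrightarrow> X \<inter> Y \<in> F"
    using lat unfolding set_lattice_def by blast+
  have Inter: "\<Inter> G \<in> F" if "finite G" "G \<noteq> {}" "G \<subseteq> F" for G
    using that by (induction rule: finite_ne_induct) (simp_all add: F(5))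
  have Union: "\<Union> G \<in> F" if "finite G" "G \<subseteq> F" for G
    using that by (induction rule: finite_induct) (simp_all add: F(2,4))
  have I: "I x \<in> F" if "x \<in> Y" for x
    unfolding I_def
  proof (rule Inter)
    show "{Z \<in> F. x \<in> Z} \<noteq> {}" using F(1) that YA by blast
  qed (use fin in auto)
  then have "I ` Y \<subseteq> F" by blast
  then have "\<Union> (I ` Y) \<in> F" using Union finite_subset fin by blast
  moreover have "\<Union> (I ` Y) = Y"
  proof
    show "\<Union> (I ` Y) \<subseteq> Y" using sep I F(3) unfolding I_def by blast
    show "Y \<subseteq> \<Union> (I ` Y)" unfolding I_def by blast
  qed
  ultimately show ?thesis by simp
qed

lemma preimage_closed_if_affinely_interpolated:
  fixes R (structure)
  assumes R: "cring R" and f: "affinely_interpolated R f"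
    and lat: "set_lattice (carrier R) F" and fin: "finite F" and tr: "translation_closed R F"
  shows "preimage_closed R f F"
  unfolding preimage_closed_def
proof (intro ballI finite_set_lattice_mem[OF lat fin])
  interpret cring R by (rule R)
  fix X assume X: "X \<in> F"
  show "{x \<in> carrier R. f x \<in> X} \<subseteq> carrier R" by blast
  fix x y assume x: "x \<in> {x \<in> carrier R. f x \<in> X}" and y: "y \<in> carrier R"
    and sep: "\<And>Z. \<lbrakk>Z \<in> F; x \<in> Z\<rbrakk> \<Longrightarrow> y \<in> Z"
  obtain a b where ab: "a \<in> carrier R" "b \<in> carrier R"
    and eq: "f x = a \<otimes> x \<oplus> b" "f y = a \<otimes> y \<oplus> b"
    using f x y unfolding affinely_interpolated_def by blast
  have "{z \<in> carrier R. a \<otimes> z \<in> {z \<in> carrier R. z \<oplus> b \<in> X}} \<in> F"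
    using tr X ab unfolding translation_closed_def by blast
  from sep[OF this] show "y \<in> {x \<in> carrier R. f x \<in> X}" using x y ab eq by simp
qed

section \<open>Residues and division in the p-adic integers\<close>

lemma padic_component_bounds:
  assumes "x \<in> carrier (padic_ints p)"
  shows "0 \<le> x n" "x n < int p ^ n"
  using assms by (simp_all add: padic_ints_def)

lemma padic_component_mod:
  assumes "x \<in> carrier (padic_ints p)" "m \<le> n"
  shows "x n mod int p ^ m = x m"
  using assms by (simp add: padic_ints_def)

lemma padic_add_component: "(x \<oplus>\<^bsub>padic_ints p\<^esub> y) n = (x n + y n) mod int p ^ n"
  and padic_mult_component: "(x \<otimes>\<^bsub>padic_ints p\<^esub> y) n = (x n * y n) mod int p ^ n"
  by (simp_all add: padic_ints_def)

lemma padic_minus_component: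
  assumes p: "p > 0" and x: "x \<in> carrier (padic_ints p)" and y: "y \<in> carrier (padic_ints p)"
  shows "(x \<ominus>\<^bsub>padic_ints p\<^esub> y) n = (x n - y n) mod int p ^ n"
proof -
  interpret cring "padic_ints p" by (rule padic_ints_cring[OF p])
  let ?d = "x \<ominus>\<^bsub>padic_ints p\<^esub> y"
  have d: "?d \<in> carrier (padic_ints p)" using x y by simp
  have "x = ?d \<oplus>\<^bsub>padic_ints p\<^esub> y" using x y by algebra
  then have "x n = (?d n + y n) mod int p ^ n" using padic_add_component by metis
  then have "(x n - y n) mod int p ^ n = ?d n mod int p ^ n" by (simp add: mod_simps)
  then show ?thesis using padic_component_mod[OF d, of n n] by simp
qed

text \<open>Write \<open>d = p^v u\<close> and \<open>e = p^v w\<close>, where \<open>u\<close> is a unit. The components of \<open>u\<close> and \<open>w\<close>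
  modulo \<open>p^n\<close> are read off the components of \<open>d\<close> and \<open>e\<close> at \<open>n + v\<close>, and the component of
  the quotient modulo \<open>p^n\<close> is the solution \<open>a\<close> of \<open>a u = w\<close>; these solutions are compatible
  because they are unique.\<close>

lemma padic_dvd_if_valuation_le:
  assumes p: "prime p" and d: "d \<in> carrier (padic_ints p)" and e: "e \<in> carrier (padic_ints p)"
    and dv: "d v = 0" and dSv: "d (Suc v) \<noteq> 0" and ev: "e v = 0"
  shows "\<exists>a\<in>carrier (padic_ints p). e = a \<otimes>\<^bsub>padic_ints p\<^esub> d"
proof -
  let ?P = "int p"
  have P0: "?P > 0" using p prime_gt_0_nat by simp
  have primeP: "prime ?P" using p by simp
  have pd: "?P ^ v dvd d (n + v)" "?P ^ v dvd e (n + v)" for n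
    using padic_component_mod[OF d, of v "n + v"] padic_component_mod[OF e, of v "n + v"] dv ev
    by (auto simp: mod_eq_0_iff_dvd)
  define u w where "u n = d (n + v) div ?P ^ v" and "w n = e (n + v) div ?P ^ v" for n
  have du: "d (n + v) = ?P ^ v * u n" and ew: "e (n + v) = ?P ^ v * w n" for n
    using pd[of n] by (simp_all add: u_def w_def)
  have compat: "[u n = u m] (mod ?P ^ m)" "[w n = w m] (mod ?P ^ m)" if "m \<le> n" for m n
  proof -
    have "[d (n + v) = d (m + v)] (mod ?P ^ v * ?P ^ m)"
      "[e (n + v) = e (m + v)] (mod ?P ^ v * ?P ^ m)"
      using padic_component_mod[OF d, of "m + v" "n + v"] padic_component_mod[OF d, of "m + v" "m + v"]
        padic_component_mod[OF e, of "m + v" "n + v"] padic_component_mod[OF e, of "m + v" "m + v"] that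
      by (simp_all add: cong_def power_add mult.commute)
    then show "[u n = u m] (mod ?P ^ m)" "[w n = w m] (mod ?P ^ m)"
      unfolding du ew using P0
      by (simp_all add: cong_iff_dvd_diff flip: right_diff_distrib)
  qed
  have cop: "coprime (u n) (?P ^ n)" for n
  proof (cases n)
    case (Suc k)
    have "\<not> ?P dvd u 1"
    proof
      assume "?P dvd u 1"
      then have "?P ^ Suc v dvd d (Suc v)" using du[of 1] by (auto simp: dvd_def)
      then show False
        using dSv padic_component_bounds[OF d, of "Suc v"] zdvd_imp_le[of "?P ^ Suc v" "d (Suc v)"]
        by fastforce
    qed
    moreover have "[u n = u 1] (mod ?P)" using compat(1)[of 1 n] Suc by simp
    ultimately have "\<not> ?P dvd u n" using cong_dvd_iff cong_sym by blast
    then have "coprime ?P (u n)" using primeP prime_imp_coprime by blast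
    then show ?thesis by (simp add: coprime_commute)
  qed simp
  have "\<exists>c. [c * u n = w n] (mod ?P ^ n)" for n
  proof -
    obtain i where "[u n * i = 1] (mod ?P ^ n)" using cong_solve_coprime_int[OF cop] by blast
    then have "[w n * (u n * i) = w n * 1] (mod ?P ^ n)" by (rule cong_scalar_left)
    then have "[(w n * i) * u n = w n] (mod ?P ^ n)" by (simp add: algebra_simps)
    then show ?thesis by blast
  qed
  then obtain c where c: "\<And>n. [c n * u n = w n] (mod ?P ^ n)" by metis
  define a where "a n = c n mod ?P ^ n" for n
  have au: "[a n * u n = w n] (mod ?P ^ n)" for n
    using c[of n] by (simp add: a_def cong_def mod_simps)
  have ared: "a n mod ?P ^ m = a m" if mn: "m \<le> n" for m n
  proof -
    have "[a n * u n = w n] (mod ?P ^ m)"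
      using au cong_dvd_modulus le_imp_power_dvd[OF mn] by blast
    then have "[a n * u m = w m] (mod ?P ^ m)"
      using compat[OF mn] by (meson cong_scalar_left cong_sym cong_trans)
    then have "[a n * u m = a m * u m] (mod ?P ^ m)" using au cong_sym cong_trans by blast
    then have "[a n = a m] (mod ?P ^ m)" using cong_mult_rcancel cop by blast
    then show ?thesis by (simp add: cong_def a_def)
  qed
  have "a \<in> carrier (padic_ints p)"
    using ared P0 by (simp add: padic_ints_def a_def)
  moreover have "e = a \<otimes>\<^bsub>padic_ints p\<^esub> d"
  proof
    fix n
    have "[a n * u n * ?P ^ v = w n * ?P ^ v] (mod ?P ^ n)" by (rule cong_scalar_right[OF au])
    then have "[a n * d (n + v) = e (n + v)] (mod ?P ^ n)" by (simp add: du ew ac_simps)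
    moreover have "[d (n + v) = d n] (mod ?P ^ n)" "[e (n + v) = e n] (mod ?P ^ n)"
      using padic_component_mod[OF d, of n] padic_component_mod[OF e, of n]
      by (simp_all add: cong_def)
    ultimately have "[a n * d n = e n] (mod ?P ^ n)"
      by (meson cong_scalar_left cong_sym cong_trans)
    then show "e n = (a \<otimes>\<^bsub>padic_ints p\<^esub> d) n"
      using padic_component_mod[OF e, of n n] by (simp add: padic_mult_component cong_def)
  qed
  ultimately show ?thesis by blast
qed

lemma recognizes_padic_residue_class:
  assumes p: "p > 0"
  shows "recognizes (padic_ints p) ((\<lambda>z. z n) ` carrier (padic_ints p))
    (\<lambda>u v. (u + v) mod int p ^ n) (\<lambda>u v. (u * v) mod int p ^ n) (\<lambda>z. z n)
    {z \<in> carrier (padic_ints p). z n = c}"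
proof -
  interpret cring "padic_ints p" by (rule padic_ints_cring[OF p])
  let ?M = "(\<lambda>z. z n) ` carrier (padic_ints p)"
  have "?M \<subseteq> {0..<int p ^ n}" using padic_component_bounds by fastforce
  then have "finite ?M" using finite_subset by blast
  moreover have "(u + v) mod int p ^ n \<in> ?M \<and> (u * v) mod int p ^ n \<in> ?M"
    if "u \<in> ?M" "v \<in> ?M" for u v
    using that by (auto simp flip: padic_add_component padic_mult_component)
  ultimately show ?thesis
    unfolding recognizes_def by (auto simp: padic_add_component padic_mult_component)
qed

text \<open>All members of the lattice of the residue class of \<open>f x\<close> are unions of residue classes,
  the preimage of this class under \<open>f\<close> included. As it contains \<open>x\<close>, it contains \<open>y\<close>.\<close>

lemma residue_preserving_if_preimage_closed:
  assumes p: "p > 0" and f: "f \<in> carrier (padic_ints p) \<rightarrow> carrier (padic_ints p)"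
    and closed: "\<And>L. recognizable (padic_ints p) L \<Longrightarrow>
       preimage_closed (padic_ints p) f (generated_lattice (padic_ints p) L)"
    and x: "x \<in> carrier (padic_ints p)" and y: "y \<in> carrier (padic_ints p)" and eq: "x n = y n"
  shows "f x n = f y n"
proof -
  let ?L = "{z \<in> carrier (padic_ints p). z n = f x n}"
  note rec = recognizes_padic_residue_class[OF p, of n "f x n"]
  have "?L \<subseteq> carrier (padic_ints p)" by blast
  then have "{z \<in> carrier (padic_ints p). f z \<in> ?L} \<in> generated_lattice (padic_ints p) ?L"
    using closed[OF recognizes_imp_recognizable[OF rec]] generated_lattice_least(3)
    unfolding preimage_closed_def by blast
  moreover have "x \<in> {z \<in> carrier (padic_ints p). f z \<in> ?L}" using x f by auto
  ultimately have "y \<in> {z \<in> carrier (padic_ints p). f z \<in> ?L}"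
    using generated_lattice_saturated[OF padic_ints_cring[OF p] rec, OF _ _ y] eq by blast
  then show ?thesis by simp
qed

lemma affinely_interpolated_if_residue_preserving:
  assumes p: "prime p" and f: "f \<in> carrier (padic_ints p) \<rightarrow> carrier (padic_ints p)"
    and res: "\<And>x y n. \<lbrakk>x \<in> carrier (padic_ints p); y \<in> carrier (padic_ints p); x n = y n\<rbrakk>
       \<Longrightarrow> f x n = f y n"
  shows "affinely_interpolated (padic_ints p) f"
proof -
  have p0: "p > 0" by (rule prime_gt_0_nat[OF p])
  interpret cring "padic_ints p" by (rule padic_ints_cring[OF p0])
  show ?thesis
  proof (rule affinely_interpolatedI[OF f])
    fix x y assume xy: "x \<in> carrier (padic_ints p)" "y \<in> carrier (padic_ints p)"
    then have fxy: "f x \<in> carrier (padic_ints p)" "f y \<in> carrier (padic_ints p)" using f by auto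
    show "\<exists>a\<in>carrier (padic_ints p). f x \<ominus>\<^bsub>padic_ints p\<^esub> f y
        = a \<otimes>\<^bsub>padic_ints p\<^esub> (x \<ominus>\<^bsub>padic_ints p\<^esub> y)"
    proof (cases "x = y")
      case True
      have "f y \<ominus>\<^bsub>padic_ints p\<^esub> f y = \<zero>\<^bsub>padic_ints p\<^esub> \<otimes>\<^bsub>padic_ints p\<^esub> (y \<ominus>\<^bsub>padic_ints p\<^esub> y)"
        using xy fxy by algebra
      then show ?thesis using True zero_closed by blast
    next
      case False
      then obtain n where "x n \<noteq> y n" by blast
      moreover have "x 0 = y 0"
        using padic_component_bounds[of x p 0] padic_component_bounds[of y p 0] xy by simp
      (* v is the valuation of x - y: components at index 0 carry no information and agree. *)
      ultimately obtain v where v: "x v = y v" "x (Suc v) \<noteq> y (Suc v)"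
        using ex_least_nat_less[of "\<lambda>n. x n \<noteq> y n" n] by blast
      show ?thesis
      proof (rule padic_dvd_if_valuation_le[OF p, where v = v])
        show "(x \<ominus>\<^bsub>padic_ints p\<^esub> y) v = 0" "(f x \<ominus>\<^bsub>padic_ints p\<^esub> f y) v = 0"
          using v(1) res[OF xy] by (simp_all add: padic_minus_component p0 xy fxy)
        have "x (Suc v) mod int p ^ Suc v \<noteq> y (Suc v) mod int p ^ Suc v"
          using v(2) padic_component_mod[of _ p "Suc v" "Suc v"] xy by simp
        then show "(x \<ominus>\<^bsub>padic_ints p\<^esub> y) (Suc v) \<noteq> 0"
          by (simp add: padic_minus_component p0 xy mod_eq_dvd_iff mod_eq_0_iff_dvd)
      qed (use xy fxy in simp_all)
    qed
  qed
qed

theorem proposition6p7: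
  fixes p :: nat and f :: "(nat \<Rightarrow> int) \<Rightarrow> (nat \<Rightarrow> int)"
  assumes "prime p"
    and "f \<in> carrier (padic_ints p) \<rightarrow> carrier (padic_ints p)"
  shows "congruence_preserving (padic_ints p) f \<longleftrightarrow>
    (\<forall>L. recognizable (padic_ints p) L \<longrightarrow>
       preimage_closed (padic_ints p) f (generated_lattice (padic_ints p) L))"
proof -
  have p0: "p > 0" by (rule prime_gt_0_nat[OF assms(1)])
  note R = padic_ints_cring[OF p0]
  have "affinely_interpolated (padic_ints p) f \<longleftrightarrow>
    (\<forall>L. recognizable (padic_ints p) L \<longrightarrow>
       preimage_closed (padic_ints p) f (generated_lattice (padic_ints p) L))" (is "_ \<longleftrightarrow> ?closed")
  proof
    assume int: "affinely_interpolated (padic_ints p) f"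
    show ?closed
    proof (intro allI impI)
      fix L assume L: "recognizable (padic_ints p) L"
      then have "L \<subseteq> carrier (padic_ints p)" unfolding recognizable_def recognizes_def by blast
      then show "preimage_closed (padic_ints p) f (generated_lattice (padic_ints p) L)"
        using preimage_closed_if_affinely_interpolated[OF R int] generated_lattice_least(1,2)
          finite_generated_lattice[OF R L] by blast
    qed
  next
    assume ?closed
    then have "f x n = f y n"
      if "x \<in> carrier (padic_ints p)" "y \<in> carrier (padic_ints p)" "x n = y n" for x y n
      using residue_preserving_if_preimage_closed[OF p0 assms(2)] that by blast
    then show "affinely_interpolated (padic_ints p) f"
      by (rule affinely_interpolated_if_residue_preserving[OF assms])
  qed
  then show ?thesis
    using cring.congruence_preserving_iff_affine_interpolation[OF R assms(2)] by blast
qed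

end
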